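(* The quantity $\lambda_\phi$ is bounded uniformly away from $\frac12$ for $\phi\in(0,\pi)$, i.e. there exists $\delta>0$ such that $\lambda_\phi\geq\frac12+\delta$ for all $\phi\in(0,\pi)$. Thus $\sup\{\lambda_\phi^{-1}:\phi\in(0,\pi)\}<2$.
   Context: Let $\mathcal{F}=\{T(w)=1+\sum_{j=1}^\infty a_jw^j : a_j\in[-1,1] \text{ for all } j\geq1\}$, regarded as a set of analytic functions on the open unit disk. For an angle $\phi$, let $$\lambda_\phi=\min\{|\lambda| : \lambda \text{ is a zero of some function in } \mathcal{F} \text{ and the argument of } \lambda \text{ is } \phi\}.$$ *)

theory Defs
  imports "HOL-Complex_Analysis.Complex_Analysis"
begin

text \<open>Only the values on the open unit disk are constrained; values elsewhere are never used.\<close>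

definition series_class :: "(complex \<Rightarrow> complex) set" where
  "series_class = {T. \<exists>a :: nat \<Rightarrow> real. (\<forall>j\<ge>1. a j \<in> {-1..1}) \<and>
     (\<forall>w\<in>ball 0 1. T w = 1 + (\<Sum>j. of_real (a (Suc j)) * w ^ Suc j))}"

definition zero_moduli :: "real \<Rightarrow> real set" where
  "zero_moduli \<phi> = {cmod z |z T. T \<in> series_class \<and> z \<in> ball 0 1 \<and> T z = 0 \<and> is_Arg z \<phi>}"

text \<open>The least element of the set of moduli, not its infimum: the value is
  unspecified when no minimum is attained.\<close>

definition min_modulus :: "real \<Rightarrow> real" where
  "min_modulus \<phi> = (LEAST r. r \<in> zero_moduli \<phi>)"

end

theory Submission
  imports Defs
begin

text \<open>
  A zero \<open>r e\<^sup>i\<^sup>\<phi>\<close> of \<open>1 + \<Sum> a\<^sub>j w\<^sup>j\<close> with \<open>sin \<phi> \<noteq> 0\<close> satisfies, for every real \<open>t\<close>,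
  the real equation \<open>1 + \<Sum> a\<^sub>j r\<^sup>j (cos j\<phi> - t sin j\<phi> / sin \<phi>) = 0\<close>, so that
  \<open>1 \<le> \<Sum> r\<^sup>j \<bar>cos j\<phi> - t sin j\<phi> / sin \<phi>\<bar>\<close>. At \<open>r = 1/2\<close> the choice \<open>t = 0\<close> violates this
  when \<open>\<bar>cos \<phi>\<bar>\<close> is bounded away from 1. When \<open>\<bar>cos \<phi>\<bar>\<close> is close to 1, \<open>sin j\<phi> / sin \<phi>\<close> is
  close to \<open>\<plusminus>j\<close>, and a small \<open>t\<close> with the sign of \<open>cos \<phi>\<close> violates it as well; in both cases
  there is room to spare, which gives the uniform gap.
  The minimum defining \<open>\<lambda>\<^sub>\<phi>\<close> is attained because the coefficient space \<open>[-1,1]\<^sup>\<nat>\<close> is compact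
  (Tychonoff), and zeros on the ray exist because the vectors \<open>r\<^sup>j e\<^sup>i\<^sup>j\<^sup>\<phi>\<close> have a large Gram matrix
  as \<open>r\<close> approaches 1.
\<close>

section \<open>Zeros on a ray\<close>

text \<open>The index shift pairs \<open>a j\<close> with the power \<open>Suc j\<close>, so the
  admissible sequences form the full product \<open>UNIV \<rightarrow> {-1..1}\<close>, without an
  exceptional coordinate at 0.\<close>

definition ray_series :: "real \<Rightarrow> (nat \<Rightarrow> real) \<Rightarrow> real \<Rightarrow> complex" where
  "ray_series \<phi> a r = 1 + (\<Sum>j. of_real (a j) * (of_real r * cis \<phi>) ^ Suc j)"

text \<open>Turns membership into a condition on a pair of coefficient sequence and radius, the form
  to which compactness applies.\<close>

lemma zero_moduli_iff:
  "r \<in> zero_moduli \<phi> \<longleftrightarrow>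
     0 \<le> r \<and> r < 1 \<and> (\<exists>a\<in>UNIV \<rightarrow> {-1..1}. ray_series \<phi> a r = 0)"
proof
  assume "r \<in> zero_moduli \<phi>"
  then obtain z T where z: "r = cmod z" "T \<in> series_class" "z \<in> ball 0 1" "T z = 0" "is_Arg z \<phi>"
    unfolding zero_moduli_def by blast
  then obtain a :: "nat \<Rightarrow> real" where a: "\<forall>j\<ge>1. a j \<in> {-1..1}"
     "\<forall>w\<in>ball 0 1. T w = 1 + (\<Sum>j. of_real (a (Suc j)) * w ^ Suc j)"
    unfolding series_class_def by blast
  have "z = of_real r * cis \<phi>"
    using z(5) unfolding is_Arg_def cis_conv_exp z(1) .
  then have "ray_series \<phi> (\<lambda>j. a (Suc j)) r = 0"
    using a(2) z(3,4) by (simp add: ray_series_def del: power_Suc)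
  with a z show "0 \<le> r \<and> r < 1 \<and> (\<exists>a\<in>UNIV \<rightarrow> {-1..1}. ray_series \<phi> a r = 0)"
    by (intro conjI bexI[of _ "\<lambda>j. a (Suc j)"]) auto
next
  assume "0 \<le> r \<and> r < 1 \<and> (\<exists>a\<in>UNIV \<rightarrow> {-1..1}. ray_series \<phi> a r = 0)"
  then obtain a where r: "0 \<le> r" "r < 1" and a: "a \<in> UNIV \<rightarrow> {-1..1}" "ray_series \<phi> a r = 0"
    by blast
  let ?z = "of_real r * cis \<phi>"
  let ?T = "\<lambda>w. 1 + (\<Sum>j. of_real (a j) * w ^ Suc j)"
  have n: "cmod ?z = r"
    using r by (simp add: norm_mult)
  have "?T \<in> series_class"
    unfolding series_class_def using a by (auto intro!: exI[of _ "\<lambda>j. a (j - 1)"])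
  moreover have "?T ?z = 0"
    using a(2) unfolding ray_series_def .
  moreover have "is_Arg ?z \<phi>"
    unfolding is_Arg_def n by (simp only: cis_conv_exp)
  moreover have "?z \<in> ball 0 1"
    using n r by simp
  ultimately show "r \<in> zero_moduli \<phi>"
    unfolding zero_moduli_def mem_Collect_eq using n by (intro exI[of _ ?z] exI[of _ ?T]) simp
qed

lemma ray_term_bound:
  assumes "a \<in> UNIV \<rightarrow> {-1..1::real}" "0 \<le> r" "r \<le> \<rho>"
  shows "cmod (of_real (a j) * (of_real r * cis \<phi>) ^ Suc j) \<le> \<rho> ^ Suc j"
proof -
  have "\<bar>a j\<bar> \<le> 1"
    using assms(1) by (auto simp: Pi_iff abs_le_iff minus_le_iff)
  moreover have "r ^ Suc j \<le> \<rho> ^ Suc j"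
    using assms by (intro power_mono) auto
  ultimately have "\<bar>a j\<bar> * r ^ Suc j \<le> 1 * \<rho> ^ Suc j"
    using assms by (intro mult_mono) auto
  then show ?thesis
    using assms(2) by (simp add: norm_mult norm_power del: power_Suc)
qed

lemma summable_power_Suc: "\<bar>x\<bar> < 1 \<Longrightarrow> summable (\<lambda>j. x ^ Suc j :: real)"
  using summable_geometric[of x] summable_Suc_iff[of "\<lambda>j. x ^ j"] by simp

section \<open>The minimum is attained\<close>

text \<open>A partial sum involves finitely many coordinates, hence is continuous in the product
  topology; the majorant \<open>\<rho> ^ Suc j\<close> makes the convergence uniform. For negative
  \<rho> the domain is empty.\<close>

lemma continuous_on_ray_series:
  assumes "\<rho> < 1"
  shows "continuous_on ((UNIV \<rightarrow> {-1..1}) \<times> {0..\<rho>}) (\<lambda>p. ray_series \<phi> (fst p) (snd p))"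
proof (cases "0 \<le> \<rho>")
  case True
  let ?D = "(UNIV \<rightarrow> {-1..1} :: (nat \<Rightarrow> real) set) \<times> {0..\<rho>}"
  let ?f = "\<lambda>j p. of_real (fst p j) * (of_real (snd p) * cis \<phi>) ^ Suc j"
  have "uniform_limit ?D (\<lambda>n p. \<Sum>j<n. ?f j p) (\<lambda>p. \<Sum>j. ?f j p) sequentially"
  proof (rule Weierstrass_m_test)
    show "cmod (?f j p) \<le> \<rho> ^ Suc j" if "p \<in> ?D" for j p
      using that by (intro ray_term_bound) auto
    show "summable (\<lambda>j. \<rho> ^ Suc j)"
      using assms True by (intro summable_power_Suc) auto
  qed
  moreover have "continuous_on ?D (\<lambda>p. \<Sum>j<n. ?f j p)" for n
  proof -
    have "continuous_on ?D (\<lambda>p. fst p j)" for j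
      by (rule continuous_on_product_then_coordinatewise[of _ fst]) (intro continuous_intros)
    then show ?thesis
      by (intro continuous_intros)
  qed
  ultimately have "continuous_on ?D (\<lambda>p. \<Sum>j. ?f j p)"
    by (intro uniform_limit_theorem[where F = sequentially]) auto
  then show ?thesis
    unfolding ray_series_def by (intro continuous_intros)
qed auto

lemma compact_coefficients: "compact (UNIV \<rightarrow> {-1..1::real} :: (nat \<Rightarrow> real) set)"
  using compactin_PiE[of "\<lambda>_. euclidean" UNIV "\<lambda>_::nat. {-1..1::real}"]
  by (metis euclidean_product_topology PiE_UNIV_domain compactin_euclidean_iff compact_Icc)

text \<open>Projection to the radius of the closed zero set in a compact product; stopping at \<rho>
  < 1 keeps the series jointly continuous.\<close>

lemma compact_zero_moduli_segment:
  assumes "\<rho> < 1"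
  shows "compact (zero_moduli \<phi> \<inter> {0..\<rho>})"
proof -
  let ?D = "(UNIV \<rightarrow> {-1..1} :: (nat \<Rightarrow> real) set) \<times> {0..\<rho>}"
  let ?Z = "{p \<in> ?D. ray_series \<phi> (fst p) (snd p) = 0}"
  have D: "compact ?D"
    by (intro compact_Times compact_coefficients compact_Icc)
  then have "closed ?Z"
    using continuous_on_ray_series[OF assms]
    by (intro continuous_closed_preimage_constant compact_imp_closed)
  then have "compact (?D \<inter> ?Z)"
    by (intro compact_Int_closed D)
  then have "compact (snd ` (?D \<inter> ?Z))"
    by (intro compact_continuous_image continuous_intros)
  also have "snd ` (?D \<inter> ?Z) = zero_moduli \<phi> \<inter> {0..\<rho>}"
  proof (intro equalityI subsetI)
    fix r assume "r \<in> snd ` (?D \<inter> ?Z)"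
    then show "r \<in> zero_moduli \<phi> \<inter> {0..\<rho>}"
      using assms by (auto simp: zero_moduli_iff)
  next
    fix r assume r: "r \<in> zero_moduli \<phi> \<inter> {0..\<rho>}"
    then obtain a where "a \<in> UNIV \<rightarrow> {-1..1}" "ray_series \<phi> a r = 0"
      by (auto simp: zero_moduli_iff)
    with r show "r \<in> snd ` (?D \<inter> ?Z)"
      by (intro image_eqI[of _ _ "(a, r)"]) auto
  qed
  finally show ?thesis .
qed

text \<open>The coefficients are sought in the form \<open>Re (u * cnj z ^ j)\<close>, which turns \<open>T z = 0\<close> into
  the linear equation \<open>s u + c * cnj u = -2\<close> with \<open>s = \<Sum> \<bar>z\<bar>\<^sup>2\<^sup>j\<close> and \<open>c = \<Sum> z\<^sup>2\<^sup>j\<close>. Here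
  \<open>c\<close> stays bounded by \<open>1 / sin\<^sup>2 \<phi>\<close> while \<open>s\<close> is arbitrarily large.\<close>

lemma zero_moduli_nonempty:
  assumes "sin \<phi> \<noteq> 0"
  shows "zero_moduli \<phi> \<noteq> {}"
proof -
  \<comment> \<open>\<open>s\<close> exceeds the coming bound on \<open>cmod c\<close> by 2,
    \<open>r\<close> solves \<open>r^2 / (1 - r^2) = s\<close>, and \<open>u\<close> results from
    eliminating \<open>cnj u\<close> between the linear equation and its conjugate.\<close>
  define s where "s = 2 + 1 / (sin \<phi>)\<^sup>2"
  define r where "r = sqrt (s / (1 + s))"
  define z where "z = of_real r * cis \<phi>"
  define c where "c = z\<^sup>2 / (1 - z\<^sup>2)"
  define u where "u = 2 * (c - of_real s) / of_real (s\<^sup>2 - (cmod c)\<^sup>2)"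
  define a where "a = (\<lambda>j. Re (u * cnj z ^ Suc j))"
  have s: "s > 2"
    using assms by (simp add: s_def)
  have r2: "r\<^sup>2 = s / (1 + s)"
    using s by (simp add: r_def)
  have r: "0 < r" "r < 1"
    using s by (auto simp: r_def)
  have nz: "cmod z = r"
    using r by (simp add: z_def norm_mult)
  have zz: "z * cnj z = of_real (r\<^sup>2)"
    by (simp add: complex_norm_square[symmetric] nz)
  \<comment> \<open>Both factors of \<open>1 - z^2 = (1 - z) * (1 + z)\<close> have modulus at least
    \<open>\<bar>Im z\<bar>\<close>; the factor \<open>r^2\<close> then cancels in
    \<open>cmod c\<close>.\<close>
  have "r * \<bar>sin \<phi>\<bar> = \<bar>Im z\<bar>"
    using r by (simp add: z_def abs_mult)
  then have "r * \<bar>sin \<phi>\<bar> \<le> cmod (1 - z)" "r * \<bar>sin \<phi>\<bar> \<le> cmod (1 + z)"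
    using abs_Im_le_cmod[of "1 - z"] abs_Im_le_cmod[of "1 + z"] by auto
  then have "(r * \<bar>sin \<phi>\<bar>) * (r * \<bar>sin \<phi>\<bar>) \<le> cmod (1 - z) * cmod (1 + z)"
    using r by (intro mult_mono) auto
  also have "\<dots> = cmod (1 - z\<^sup>2)"
    unfolding norm_mult[symmetric] by (simp add: algebra_simps power2_eq_square)
  finally have b: "r\<^sup>2 * (sin \<phi>)\<^sup>2 \<le> cmod (1 - z\<^sup>2)"
    by (simp add: power2_eq_square ac_simps flip: abs_mult)
  have "cmod c = r\<^sup>2 / cmod (1 - z\<^sup>2)"
    by (simp add: c_def norm_divide norm_power nz)
  also have "\<dots> \<le> r\<^sup>2 / (r\<^sup>2 * (sin \<phi>)\<^sup>2)"
    using r assms b by (intro divide_left_mono) (auto intro!: mult_pos_pos less_le_trans[OF _ b])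
  also have "\<dots> = s - 2"
    using r by (simp add: s_def)
  finally have c: "cmod c \<le> s - 2" .
  have "0 < (s - cmod c) * (s + cmod c)"
    using c s norm_ge_zero[of c] by (intro mult_pos_pos) linarith+
  moreover have "s\<^sup>2 - (cmod c)\<^sup>2 = (s - cmod c) * (s + cmod c)"
    by (simp add: power2_eq_square algebra_simps)
  ultimately have pos: "s\<^sup>2 - (cmod c)\<^sup>2 = (s - cmod c) * (s + cmod c)"
      "(s - cmod c) * (s + cmod c) > 0"
    by auto
  have u: "cmod u \<le> 1"
  proof -
    have "cmod u = 2 * cmod (c - of_real s) / ((s - cmod c) * (s + cmod c))"
      unfolding u_def norm_divide norm_of_real pos(1) abs_of_pos[OF pos(2)] norm_mult by simp
    \<comment> \<open>The 2 in the numerator is at most \<open>s - cmod c\<close>, by the choice of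
      \<open>s\<close>.\<close>
    also have "\<dots> \<le> (s - cmod c) * (s + cmod c) / ((s - cmod c) * (s + cmod c))"
    proof (intro divide_right_mono mult_mono)
      show "cmod (c - of_real s) \<le> s + cmod c"
        using norm_triangle_ineq4[of c "of_real s"] s by simp
    qed (use c s pos in auto)
    finally show ?thesis
      using pos by (simp split: if_splits)
  qed
  have lin: "of_real s * u + c * cnj u = -2"
  proof -
    define d :: complex where "d = of_real (s\<^sup>2 - (cmod c)\<^sup>2)"
    have d: "d = of_real s * of_real s - c * cnj c"
      unfolding d_def of_real_diff complex_norm_square by (simp add: power2_eq_square)
    have "d \<noteq> 0"
      unfolding d_def of_real_eq_0_iff using pos by linarith
    have u: "u = 2 * (c - of_real s) / d"
      unfolding u_def d_def ..
    have "cnj d = d"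
      by (simp add: d_def)
    then have cu: "cnj u = 2 * (cnj c - of_real s) / d"
      by (simp add: u)
    have "of_real s * u + c * cnj u = (of_real s * (2 * (c - of_real s)) + c * (2 * (cnj c - of_real s))) / d"
      unfolding cu unfolding u by (simp only: times_divide_eq_right add_divide_distrib)
    also have "\<dots> = -2 * d / d"
      unfolding d by (simp add: algebra_simps)
    finally show ?thesis
      using \<open>d \<noteq> 0\<close> by simp
  qed
  have "a j \<in> {-1..1}" for j
  proof -
    have "\<bar>a j\<bar> \<le> cmod u * r ^ Suc j"
      using abs_Re_le_cmod[of "u * cnj z ^ Suc j"]
      by (simp add: a_def norm_mult norm_power nz del: power_Suc)
    also have "\<dots> \<le> 1 * 1"
      using u r by (intro mult_mono power_le_one) auto
    finally show ?thesis
      by auto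
  qed
  then have a: "a \<in> UNIV \<rightarrow> {-1..1}"
    by auto
  have geo: "(\<lambda>j. x ^ Suc j) sums (x / (1 - x))" if "cmod x < 1" for x
    using sums_mult[OF geometric_sums[OF that], of x] by simp
  have "r\<^sup>2 / (1 - r\<^sup>2) = s"
    using s by (simp add: r2 field_simps)
  moreover have "of_real (r\<^sup>2) / (1 - of_real (r\<^sup>2)) = (of_real (r\<^sup>2 / (1 - r\<^sup>2)) :: complex)"
    by simp
  ultimately have "(\<lambda>j. (of_real (r\<^sup>2) :: complex) ^ Suc j) sums of_real s"
    using geo[of "of_real (r\<^sup>2)"] r by (simp add: power_less_one_iff norm_power del: power_Suc)
  moreover have "(\<lambda>j. (z\<^sup>2) ^ Suc j) sums c"
    unfolding c_def using r by (intro geo) (simp add: norm_power nz power_less_one_iff)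
  \<comment> \<open>Writing the real part \<open>a j\<close> as half the sum with its conjugate and
    multiplying by \<open>z ^ Suc j\<close> gives exactly these terms.\<close>
  ultimately have "(\<lambda>j. (u * of_real (r\<^sup>2) ^ Suc j + cnj u * (z\<^sup>2) ^ Suc j) / 2)
     sums ((u * of_real s + cnj u * c) / 2)"
    by (intro sums_divide sums_add sums_mult)
  moreover have "(u * of_real s + cnj u * c) / 2 = -1"
    using lin by (simp add: mult.commute)
  moreover have "(u * of_real (r\<^sup>2) ^ Suc j + cnj u * (z\<^sup>2) ^ Suc j) / 2 = of_real (a j) * z ^ Suc j" for j
  proof -
    have "of_real (a j) = (u * cnj z ^ Suc j + cnj u * z ^ Suc j) / 2"
      using complex_add_cnj[of "u * cnj z ^ Suc j"] by (simp add: a_def del: power_Suc)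
    then show ?thesis
      unfolding zz[symmetric] unfolding power_mult_distrib power2_eq_square
      by (simp add: algebra_simps add_divide_distrib)
  qed
  ultimately have "(\<lambda>j. of_real (a j) * z ^ Suc j) sums (-1)"
    by simp
  then have "ray_series \<phi> a r = 0"
    by (simp add: ray_series_def sums_iff flip: z_def)
  then show ?thesis
    using a r zero_moduli_iff[of r \<phi>] by auto
qed

text \<open>Below any member \<rho> the moduli form a compact set; its least element is global,
  since the other moduli exceed \<rho>.\<close>

lemma min_modulus_in_zero_moduli:
  assumes "sin \<phi> \<noteq> 0"
  shows "min_modulus \<phi> \<in> zero_moduli \<phi>"
proof -
  obtain \<rho> where \<rho>: "\<rho> \<in> zero_moduli \<phi>"
    using zero_moduli_nonempty[OF assms] by blast
  then have "0 \<le> \<rho>" "\<rho> < 1"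
    by (auto simp: zero_moduli_iff)
  then obtain m where m: "m \<in> zero_moduli \<phi> \<inter> {0..\<rho>}" "\<forall>x\<in>zero_moduli \<phi> \<inter> {0..\<rho>}. m \<le> x"
    using compact_attains_inf[OF compact_zero_moduli_segment[of \<rho> \<phi>]] \<rho> by fastforce
  have "m \<le> x" if "x \<in> zero_moduli \<phi>" for x
    using m that by (cases "x \<le> \<rho>") (auto simp: zero_moduli_iff)
  then have "min_modulus \<phi> = m"
    unfolding min_modulus_def using m by (intro Least_equality) auto
  then show ?thesis
    using m by simp
qed

section \<open>The uniform gap\<close>

text \<open>If \<open>r \<le> R\<close>, the combination \<open>Re - t * Im / sin \<phi>\<close> of
  the zero equation expresses -1 as a series of absolute value at most \<open>S < 1\<close>.
  Division being total, the identity also holds when \<open>sin \<phi> = 0\<close>.\<close>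

lemma zero_moduli_gt:
  assumes r: "r \<in> zero_moduli \<phi>"
    and M: "\<And>j. \<bar>cos (real (Suc j) * \<phi>) - t * (sin (real (Suc j) * \<phi>) / sin \<phi>)\<bar> \<le> M j"
    and S: "(\<lambda>j. R ^ Suc j * M j) sums S" "S < 1"
  shows "R < r"
proof (rule ccontr)
  assume "\<not> R < r"
  obtain a where r01: "0 \<le> r" "r < 1" and a: "a \<in> UNIV \<rightarrow> {-1..1}" "ray_series \<phi> a r = 0"
    using r by (auto simp: zero_moduli_iff)
  define f where "f = (\<lambda>j. of_real (a j) * (of_real r * cis \<phi>) ^ Suc j)"
  define k where "k = (\<lambda>j. cos (real (Suc j) * \<phi>) - t * (sin (real (Suc j) * \<phi>) / sin \<phi>))"
  have "summable f"
    unfolding f_def using ray_term_bound[OF a(1) r01(1) order_refl] r01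
    by (intro summable_comparison_test'[OF summable_power_Suc[of r]]) auto
  then have "f sums (-1)"
    using a(2) by (simp add: sums_iff ray_series_def f_def add_eq_0_iff del: power_Suc)
  then have "(\<lambda>j. Re (f j) - t * (Im (f j) / sin \<phi>)) sums (Re (-1) - t * (Im (-1) / sin \<phi>))"
    by (intro sums_diff sums_mult sums_divide sums_Re sums_Im)
  moreover have "Re (f j) - t * (Im (f j) / sin \<phi>) = a j * r ^ Suc j * k j" for j
  proof -
    have "f j = of_real (a j * r ^ Suc j) * cis (real (Suc j) * \<phi>)"
      unfolding f_def power_mult_distrib Complex.DeMoivre by (simp del: power_Suc of_nat_Suc)
    then show ?thesis
      by (simp add: k_def algebra_simps del: power_Suc of_nat_Suc of_real_mult)
  qed
  ultimately have k: "(\<lambda>j. a j * r ^ Suc j * k j) sums (-1)"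
    by simp
  have "\<bar>a j * r ^ Suc j * k j\<bar> \<le> R ^ Suc j * M j" for j
  proof -
    have "\<bar>a j\<bar> * r ^ Suc j \<le> R ^ Suc j"
      using ray_term_bound[OF a(1) r01(1), of R j 0] \<open>\<not> R < r\<close> r01
      by (simp add: norm_mult norm_power del: power_Suc)
    then have "(\<bar>a j\<bar> * r ^ Suc j) * \<bar>k j\<bar> \<le> R ^ Suc j * M j"
      using M[of j] r01 \<open>\<not> R < r\<close> unfolding k_def by (intro mult_mono) auto
    then show ?thesis
      using r01 by (simp add: abs_mult)
  qed
  then have "\<bar>\<Sum>j. a j * r ^ Suc j * k j\<bar> \<le> (\<Sum>j. R ^ Suc j * M j)"
    using S(1) norm_suminf_le[of "\<lambda>j. a j * r ^ Suc j * k j" "\<lambda>j. R ^ Suc j * M j"]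
    by (auto simp: sums_iff simp del: power_Suc)
  then show False
    using k S by (simp add: sums_iff del: power_Suc)
qed

lemma abs_sin_multiple_le: "\<bar>sin (real n * x)\<bar> \<le> real n * \<bar>sin x\<bar>"
proof (induction n)
  case (Suc n)
  have "\<bar>sin (real (Suc n) * x)\<bar> \<le> \<bar>sin (real n * x)\<bar> * \<bar>cos x\<bar> + \<bar>cos (real n * x)\<bar> * \<bar>sin x\<bar>"
    using abs_triangle_ineq[of "sin (real n * x) * cos x" "cos (real n * x) * sin x"]
    by (simp add: algebra_simps sin_add abs_mult)
  also have "\<dots> \<le> \<bar>sin (real n * x)\<bar> * 1 + 1 * \<bar>sin x\<bar>"
    by (intro add_mono mult_mono) auto
  finally show ?case
    using Suc by (simp add: algebra_simps)
qed simp

lemma abs_sin_multiple_div_le: "\<bar>sin (real n * x) / sin x\<bar> \<le> real n"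
  using abs_sin_multiple_le[of n x] by (cases "sin x = 0") (auto simp: field_simps)

text \<open>Only the first term improves on the bound 1. At radius 1/2 the majorant sums to 19/20,
  which leaves room for 501/1000.\<close>

lemma zero_moduli_gt_moderate_cos:
  assumes "r \<in> zero_moduli \<phi>" "\<bar>cos \<phi>\<bar> \<le> 9 / 10"
  shows "501 / 1000 < r"
proof (rule zero_moduli_gt[OF assms(1), where t = 0])
  let ?M = "\<lambda>j. if j = 0 then 9 / 10 else 1 :: real"
  show "\<bar>cos (real (Suc j) * \<phi>) - 0 * (sin (real (Suc j) * \<phi>) / sin \<phi>)\<bar> \<le> ?M j" for j
    using assms(2) by auto
  have "(\<lambda>j. (501/1000) ^ 2 * (501/1000) ^ j :: real) sums ((501/1000) ^ 2 * (1 / (1 - 501/1000)))"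
    by (intro sums_mult geometric_sums) auto
  then show "(\<lambda>j. (501/1000) ^ Suc j * ?M j)
    sums ((501/1000) ^ 2 * (1 / (1 - 501/1000)) + 501/1000 * (9/10))"
    by (subst sums_iff_shift'[of _ 1, symmetric]) (simp add: power2_eq_square mult.assoc)
  show "(501/1000) ^ 2 * (1 / (1 - 501/1000)) + 501/1000 * (9/10) < (1::real)"
    by (simp add: power2_eq_square)
qed

text \<open>\<open>1\<close>, \<open>2c\<close> and \<open>4c\<^sup>2 - 1\<close> are the quotients \<open>sin j\<phi> / sin \<phi>\<close> for \<open>c = cos \<phi>\<close>; each
  bound is the value at \<open>c = 1\<close>.\<close>

lemma cos_minus_sin_quotient_bounds:
  fixes c :: real
  assumes "9 / 10 \<le> c" "c \<le> 1"
  shows "\<bar>c - 1/10\<bar> \<le> 9/10"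
    and "\<bar>(2 * c\<^sup>2 - 1) - 1/10 * (2 * c)\<bar> \<le> 8/10"
    and "\<bar>(4 * c ^ 3 - 3 * c) - 1/10 * (4 * c\<^sup>2 - 1)\<bar> \<le> 7/10"
proof -
  have c2: "81/100 \<le> c\<^sup>2"
    using power_mono[OF assms(1), of 2] by (simp add: power2_eq_square)
  show "\<bar>c - 1/10\<bar> \<le> 9/10"
    using assms by auto
  \<comment> \<open>The gap to the value at \<open>c = 1\<close> has the factor
    \<open>1 - c\<close>; the cubic below is treated likewise.\<close>
  have "0 \<le> (1 - c) * (2 * c + 18/10)"
    using assms by (intro mult_nonneg_nonneg) auto
  also have "\<dots> = 8/10 - ((2 * c\<^sup>2 - 1) - 1/10 * (2 * c))"
    by (simp add: field_simps power2_eq_square)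
  finally show "\<bar>(2 * c\<^sup>2 - 1) - 1/10 * (2 * c)\<bar> \<le> 8/10"
    using c2 assms by (auto simp: abs_le_iff)
  have "0 \<le> (1 - c) * (4 * c\<^sup>2 + 36/10 * c + 6/10)"
    using assms by (intro mult_nonneg_nonneg) auto
  also have "\<dots> = 7/10 - ((4 * c ^ 3 - 3 * c) - 1/10 * (4 * c\<^sup>2 - 1))"
    by (simp add: field_simps power2_eq_square power3_eq_cube)
  finally have up: "(4 * c ^ 3 - 3 * c) - 1/10 * (4 * c\<^sup>2 - 1) \<le> 7/10"
    by simp
  \<comment> \<open>For the lower bound, replacing \<open>c\<^sup>2\<close> by 81/100 leaves an
    expression linear in \<open>c\<close>.\<close>
  have "81/100 * (4 * c - 4/10) \<le> c\<^sup>2 * (4 * c - 4/10)"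
    using c2 assms by (intro mult_right_mono) auto
  moreover have "(4 * c ^ 3 - 3 * c) - 1/10 * (4 * c\<^sup>2 - 1) = c\<^sup>2 * (4 * c - 4/10) - 3 * c + 1/10"
    by (simp add: field_simps power2_eq_square power3_eq_cube)
  ultimately show "\<bar>(4 * c ^ 3 - 3 * c) - 1/10 * (4 * c\<^sup>2 - 1)\<bar> \<le> 7/10"
    using up assms by (intro abs_leI) argo+
qed

text \<open>Replacing \<open>c\<close> by \<open>- c\<close> flips the sign of the first and third
  expressions and fixes the second, so positive \<open>c\<close> suffices.\<close>

lemma cos_minus_signed_sin_quotient_bounds:
  fixes c :: real
  assumes "9 / 10 \<le> \<bar>c\<bar>" "\<bar>c\<bar> \<le> 1"
  shows "\<bar>c - sgn c / 10\<bar> \<le> 9/10"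
    and "\<bar>(2 * c\<^sup>2 - 1) - sgn c / 10 * (2 * c)\<bar> \<le> 8/10"
    and "\<bar>(4 * c ^ 3 - 3 * c) - sgn c / 10 * (4 * c\<^sup>2 - 1)\<bar> \<le> 7/10"
proof -
  have "\<bar>c - sgn c / 10\<bar> \<le> 9/10 \<and>
    \<bar>(2 * c\<^sup>2 - 1) - sgn c / 10 * (2 * c)\<bar> \<le> 8/10 \<and>
    \<bar>(4 * c ^ 3 - 3 * c) - sgn c / 10 * (4 * c\<^sup>2 - 1)\<bar> \<le> 7/10"
  proof (cases "c > 0")
    case True
    then show ?thesis
      using cos_minus_sin_quotient_bounds[of c] assms by simp
  next
    case False
    then have c: "9 / 10 \<le> - c" "- c \<le> 1" "sgn c = -1"
      using assms by (auto simp: sgn_if)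
    have "c - sgn c / 10 = - (- c - 1/10)"
      "(2 * c\<^sup>2 - 1) - sgn c / 10 * (2 * c) = (2 * (- c)\<^sup>2 - 1) - 1/10 * (2 * - c)"
      "(4 * c ^ 3 - 3 * c) - sgn c / 10 * (4 * c\<^sup>2 - 1)
        = - ((4 * (- c) ^ 3 - 3 * - c) - 1/10 * (4 * (- c)\<^sup>2 - 1))"
      by (simp_all add: c(3))
    then show ?thesis
      using cos_minus_sin_quotient_bounds[OF c(1,2)] by (simp only: abs_minus_cancel simp_thms)
  qed
  then show "\<bar>c - sgn c / 10\<bar> \<le> 9/10"
    and "\<bar>(2 * c\<^sup>2 - 1) - sgn c / 10 * (2 * c)\<bar> \<le> 8/10"
    and "\<bar>(4 * c ^ 3 - 3 * c) - sgn c / 10 * (4 * c\<^sup>2 - 1)\<bar> \<le> 7/10"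
    by blast+
qed

text \<open>The first three terms gain 1/10, 2/10 and 3/10 over the bound 1, outweighing the loss in
  the tail: at radius 1/2 the majorant sums to less than 0.93.\<close>

lemma zero_moduli_gt_large_cos:
  assumes r: "r \<in> zero_moduli \<phi>" and c: "9 / 10 \<le> \<bar>cos \<phi>\<bar>" and s: "sin \<phi> \<noteq> 0"
  shows "501 / 1000 < r"
proof (rule zero_moduli_gt[OF r, where t = "sgn (cos \<phi>) / 10"])
  let ?U = "\<lambda>j. sin (real (Suc j) * \<phi>) / sin \<phi>"
  let ?M = "\<lambda>j. if j = 0 then 9/10 else if j = 1 then 8/10 else if j = 2 then 7/10
     else 1 + 4/10 * (5/4) ^ (j - 3) :: real"
  show "\<bar>cos (real (Suc j) * \<phi>) - sgn (cos \<phi>) / 10 * ?U j\<bar> \<le> ?M j" for j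
  proof -
    let ?c = "cos \<phi>"
    have c1: "\<bar>?c\<bar> \<le> 1"
      by (rule abs_cos_le_one)
    consider "j = 0" | "j = 1" | "j = 2" | "j \<ge> 3"
      by linarith
    then show ?thesis
    proof cases
      case 1
      then show ?thesis
        using cos_minus_signed_sin_quotient_bounds(1)[OF c c1] s by simp
    next
      case 2
      have "?U j = 2 * ?c"
        using s 2 by (simp add: sin_double)
      moreover have "cos (real (Suc j) * \<phi>) = 2 * ?c\<^sup>2 - 1"
        using 2 by (simp add: cos_double_cos)
      ultimately show ?thesis
        using cos_minus_signed_sin_quotient_bounds(2)[OF c c1] 2 by simp
    next
      case 3
      have e: "real (Suc j) * \<phi> = 2 * \<phi> + \<phi>"
        using 3 by simp
      have "sin (real (Suc j) * \<phi>) = sin \<phi> * (4 * ?c\<^sup>2 - 1)"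
        unfolding e sin_add sin_double cos_double_cos
        by (simp add: power2_eq_square algebra_simps)
      then have "?U j = 4 * ?c\<^sup>2 - 1"
        using s by simp
      moreover have "cos (real (Suc j) * \<phi>) = 4 * ?c ^ 3 - 3 * ?c"
        using cos_treble_cos[of \<phi>] 3 by simp
      ultimately show ?thesis
        using cos_minus_signed_sin_quotient_bounds(3)[OF c c1] 3 by simp
    next
      case 4
      define i where "i = j - 3"
      have j: "j = i + 3"
        using 4 by (simp add: i_def)
      have "\<bar>sgn ?c / 10 * ?U j\<bar> = \<bar>sgn ?c\<bar> / 10 * \<bar>?U j\<bar>"
        by (simp add: abs_mult)
      also have "\<dots> \<le> 1 / 10 * real (Suc j)"
        by (intro mult_mono abs_sin_multiple_div_le) (auto simp: sgn_if)
      finally have "\<bar>cos (real (Suc j) * \<phi>) - sgn ?c / 10 * ?U j\<bar> \<le> 1 + real (Suc j) / 10"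
        using abs_triangle_ineq4[of "cos (real (Suc j) * \<phi>)" "sgn ?c / 10 * ?U j"]
          abs_cos_le_one[of "real (Suc j) * \<phi>"] by linarith
      \<comment> \<open>Bernoulli trades the linear growth \<open>(i + 4) / 10\<close> for a
        geometric one, so that the tail has a closed form; the ratio 5/4 makes this an equality at
        \<open>i = 0\<close> and \<open>i = 1\<close>.\<close>
      also have "\<dots> \<le> 1 + 4/10 * (5/4) ^ i"
        using Bernoulli_inequality[of "1/4 :: real" i] by (simp add: j field_simps)
      finally show ?thesis
        using j by simp
    qed
  qed
  let ?R = "501/1000 :: real"
  let ?S = "?R ^ 4 * (1 / (1 - ?R)) + 4/10 * ?R ^ 4 * (1 / (1 - 5/4 * ?R))"
  have "(\<lambda>j. ?R ^ 4 * ?R ^ j + 4/10 * ?R ^ 4 * (5/4 * ?R) ^ j) sums ?S"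
    by (intro sums_add sums_mult geometric_sums) auto
  moreover have "R ^ 4 * R ^ j + 4/10 * R ^ 4 * (5/4 * R) ^ j = R ^ Suc (j + 3) * ?M (j + 3)"
    for R :: real and j
    unfolding power_mult_distrib by (simp add: algebra_simps eval_nat_numeral del: power_divide)
  ultimately have "(\<lambda>j. ?R ^ Suc (j + 3) * ?M (j + 3)) sums ?S"
    by (simp only:)
  then show "(\<lambda>j. ?R ^ Suc j * ?M j) sums (?S + (\<Sum>j<3. ?R ^ Suc j * ?M j))"
    by (subst (asm) sums_iff_shift)
  show "?S + (\<Sum>j<3. ?R ^ Suc j * ?M j) < 1"
    by (simp add: eval_nat_numeral)
qed

theorem theorem4p3:
  "(\<exists>\<delta>>0. \<forall>\<phi>\<in>{0<..<pi}. min_modulus \<phi> \<ge> 1/2 + \<delta>) \<and>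
   (SUP \<phi>\<in>{0<..<pi}. inverse (min_modulus \<phi>)) < 2"
proof
  have *: "min_modulus \<phi> \<ge> 1/2 + 1/1000" if "\<phi> \<in> {0<..<pi}" for \<phi>
  proof -
    have "sin \<phi> \<noteq> 0"
      using that sin_gt_zero[of \<phi>] by auto
    \<comment> \<open>The minimum is itself the modulus of a zero, so the bound for whichever side
      of 9/10 contains \<open>\<bar>cos \<phi>\<bar>\<close> applies to it.\<close>
    then have "501 / 1000 < min_modulus \<phi>"
      using zero_moduli_gt_moderate_cos zero_moduli_gt_large_cos min_modulus_in_zero_moduli
      by (metis linear)
    then show ?thesis
      by simp
  qed
  then show "\<exists>\<delta>>0. \<forall>\<phi>\<in>{0<..<pi}. min_modulus \<phi> \<ge> 1/2 + \<delta>"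
    by (intro exI[of _ "1/1000"]) auto
  have "(SUP \<phi>\<in>{0<..<pi}. inverse (min_modulus \<phi>)) \<le> 1000 / 501"
  proof (rule cSUP_least)
    show "{0<..<pi} \<noteq> {}"
      using pi_gt_zero by (simp only: greaterThanLessThan_empty_iff not_le)
    show "inverse (min_modulus \<phi>) \<le> 1000 / 501" if "\<phi> \<in> {0<..<pi}" for \<phi>
      using le_imp_inverse_le[OF *[OF that]] by simp
  qed
  then show "(SUP \<phi>\<in>{0<..<pi}. inverse (min_modulus \<phi>)) < 2"
    by simp
qed

end
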